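(* Let $F$ be a field of characteristic $0$, let $n$ and $q$ be positive integers such that $n \ge 2$ and $\frac{n}{2} \le q \le n$, let $\lambda_1, \ldots, \lambda_q$ be distinct nonzero elements of $F$, and let $D \in M_n(F)$ be the diagonal matrix whose first $q$ diagonal entries are $\lambda_1, \ldots, \lambda_q$ and all of whose other diagonal entries are zero. Let $\alpha_1, \alpha_2, \alpha_3$ be nonzero elements of $F$ such that $\alpha_1 + \alpha_2 + \alpha_3 = 0$. Then every $T \in \mathrm{sl}_n(F)$ can be written as $$T = \alpha_1 A_1 + \alpha_2 A_2 + \alpha_3 A_3$$ for some matrices $A_1, A_2, A_3 \in M_n(F)$ that are similar to $D$.
   Context: $M_n(F)$ denotes the algebra of all $n \times n$ matrices over the field $F$, and $\mathrm{sl}_n(F)$ denotes the subspace of all trace zero matrices in $M_n(F)$. Similarity is over $F$: $A$ is similar to $D$ if $A = SDS^{-1}$ for some invertible $S \in M_n(F)$. *)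

theory Defs
  imports "Jordan_Normal_Form.Matrix"
begin

(* Intended for square matrices only. *)
definition mat_trace :: "'a :: comm_monoid_add mat \<Rightarrow> 'a" where
  "mat_trace A = (\<Sum>i<dim_row A. A $$ (i, i))"

definition sl_mat :: "nat \<Rightarrow> 'a :: comm_monoid_add mat set" where
  "sl_mat n = {A \<in> carrier_mat n n. mat_trace A = 0}"

end

theory Submission
  imports Defs "Jordan_Normal_Form.Determinant"
begin

text \<open>
  In characteristic 0 every trace zero matrix is similar to one with zero diagonal, so let \<open>T\<close> have
  zero diagonal. A matrix with diagonal that of \<open>D\<close> which is triangular and whose off-diagonal part
  vanishes on the lower right block of size \<open>n - q\<close> is similar to \<open>D\<close>. Since \<open>n - q \<le> q\<close>, some
  matrix \<open>A\<^sub>3\<close> similar to \<open>D\<close> and with the same diagonal has an arbitrary prescribed lower right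
  block with zero diagonal; choose it so that \<open>T - \<alpha>\<^sub>3 A\<^sub>3\<close> vanishes there. The diagonal of
  \<open>T - \<alpha>\<^sub>3 A\<^sub>3\<close> is that of \<open>- \<alpha>\<^sub>3 D = \<alpha>\<^sub>1 D + \<alpha>\<^sub>2 D\<close>, so its upper and lower triangular parts
  are absorbed by \<open>A\<^sub>1\<close> and \<open>A\<^sub>2\<close> respectively.
\<close>

section \<open>Diagonalization of triangular matrices\<close>

lemma similar_mat_transpose:
  fixes A B :: "'a :: comm_ring_1 mat"
  assumes "similar_mat A B"
  shows "similar_mat A\<^sup>T B\<^sup>T"
proof -
  obtain n P Q where c: "{A,B,P,Q} \<subseteq> carrier_mat n n" and PQ: "P * Q = 1\<^sub>m n" "Q * P = 1\<^sub>m n"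
    and A: "A = P * B * Q"
    using similar_matD[OF assms] by blast
  have P: "P \<in> carrier_mat n n" and Q: "Q \<in> carrier_mat n n" and B: "B \<in> carrier_mat n n"
    using c by auto
  show ?thesis
  proof (rule similar_matI)
    show "{A\<^sup>T, B\<^sup>T, Q\<^sup>T, P\<^sup>T} \<subseteq> carrier_mat n n" using c by auto
    show "Q\<^sup>T * P\<^sup>T = 1\<^sub>m n" "P\<^sup>T * Q\<^sup>T = 1\<^sub>m n"
      using PQ transpose_mult[OF P Q] transpose_mult[OF Q P] by (metis transpose_one)+
    show "A\<^sup>T = Q\<^sup>T * B\<^sup>T * P\<^sup>T"
      unfolding A using P Q B
      by (simp add: transpose_mult[of _ n n _ n] assoc_mult_mat[of _ n n _ n _ n])
  qed
qed

text \<open>Repeated diagonal entries could obstruct diagonalization; \<open>row\<close> rules this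
  out by clearing, right of the diagonal, each row whose diagonal entry recurs further down.\<close>

lemma upper_triangular_similar_mat_diag:
  fixes A :: "'a :: field mat"
  assumes A: "A \<in> carrier_mat n n" and ut: "upper_triangular A"
    and diag: "\<And>i. i < n \<Longrightarrow> A $$ (i, i) = d i"
    and row: "\<And>i j k. i < j \<Longrightarrow> j < n \<Longrightarrow> d i = d j \<Longrightarrow> i < k \<Longrightarrow> k < n \<Longrightarrow> A $$ (i, k) = 0"
  shows "similar_mat A (mat_diag n d)"
proof -
  \<comment> \<open>Column \<open>j\<close> of the conjugating matrix solves \<open>(A - d j) v = 0\<close> with \<open>v j = 1\<close> by back
    substitution; where \<open>d i = d j\<close> the numerator vanishes and division by zero yields 0.\<close>
  have "\<exists>v. \<forall>i. v i = (if i = j then 1 else if j < i then 0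
            else (\<Sum>k\<in>{i<..<n}. A $$ (i, k) * v k) / (d j - d i))" for j
  proof -
    \<comment> \<open>Back substitution computes \<open>v i\<close> from the \<open>v k\<close> with
      \<open>k > i\<close>, so larger indices come first; the bound \<open>k < n\<close> makes this
      order well founded.\<close>
    define R where "R = {(k, i). i < k \<and> k < n}"
    have wf: "wf R"
      by (rule wf_subset[of "measure (\<lambda>i. n - i)"]) (auto simp: R_def)
    define F where "F = (\<lambda>v i. if i = j then 1 else if j < i then 0
            else (\<Sum>k\<in>{i<..<n}. A $$ (i, k) * v k) / (d j - d i) :: 'a)"
    have "wfrec R F i = F (wfrec R F) i" for i
      by (subst wfrec[OF wf], simp add: F_def, intro impI arg_cong[of _ _ "\<lambda>x. x / _"] sum.cong)
         (auto simp: cut_apply R_def)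
    then show ?thesis unfolding F_def by blast
  qed
  then obtain v where v: "\<And>j i. v j i = (if i = j then 1 else if j < i then 0
            else (\<Sum>k\<in>{i<..<n}. A $$ (i, k) * v j k) / (d j - d i))"
    by metis
  \<comment> \<open>Row \<open>i\<close> of \<open>(A - d j) v = 0\<close> without denominators. It
    holds also for \<open>d i = d j\<close>, where both sides vanish, and for
    \<open>i \<ge> j\<close>, where every \<open>v j k\<close> in the sum is 0.\<close>
  have v_eq: "(\<Sum>k\<in>{i<..<n}. A $$ (i, k) * v j k) = (d j - d i) * v j i" if "i < n" "j < n" for i j
  proof (cases "i < j")
    case True
    show ?thesis
    proof (cases "d i = d j")
      case True
      then show ?thesis using row[OF \<open>i < j\<close> \<open>j < n\<close> True] by simp
    next
      case False
      then show ?thesis using True by (subst (2) v) simp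
    qed
  next
    case False
    then have "(\<Sum>k\<in>{i<..<n}. A $$ (i, k) * v j k) = 0"
      by (intro sum.neutral) (auto simp: v[of j])
    then show ?thesis using False v[of j i] by auto
  qed
  define S where "S = mat n n (\<lambda>(i, j). v j i)"
  have S: "S \<in> carrier_mat n n" by (simp add: S_def)
  have AS: "A * S = S * mat_diag n d"
  proof (rule eq_matI)
    fix i j assume "i < dim_row (S * mat_diag n d)" "j < dim_col (S * mat_diag n d)"
    then have ij: "i < n" "j < n" by (auto simp: S_def mat_diag_def)
    have "(A * S) $$ (i, j) = (\<Sum>k<n. A $$ (i, k) * v j k)"
      using A ij by (simp add: S_def scalar_prod_def atLeast0LessThan)
    also have "\<dots> = (\<Sum>k\<in>{i..<n}. A $$ (i, k) * v j k)"
      using ut A ij by (intro sum.mono_neutral_right) auto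
    also have "\<dots> = A $$ (i, i) * v j i + (\<Sum>k\<in>{i<..<n}. A $$ (i, k) * v j k)"
      using ij by (subst sum.atLeast_Suc_lessThan) (auto simp: atLeastSucLessThan_greaterThanLessThan)
    also have "\<dots> = d j * v j i"
      using ij by (simp add: v_eq diag left_diff_distrib)
    also have "\<dots> = (S * mat_diag n d) $$ (i, j)"
      using ij by (subst mat_diag_mult_right[OF S]) (simp add: S_def)
    finally show "(A * S) $$ (i, j) = (S * mat_diag n d) $$ (i, j)" .
  qed (use A S in \<open>auto simp: mat_diag_def\<close>)
  have utS: "upper_triangular S"
    by (auto simp: S_def v)
  have "diag_mat S = map (\<lambda>_. 1) [0..<n]"
    by (auto simp: diag_mat_def S_def v)
  then have "det S = 1"
    using det_upper_triangular[OF utS S] by (simp add: map_replicate_const)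
  then obtain S' where S': "S' \<in> carrier_mat n n" "S * S' = 1\<^sub>m n" "S' * S = 1\<^sub>m n"
    using det_non_zero_imp_unit[OF S, of undefined]
    by (auto simp: Units_def ring_mat_def)
  have "S * mat_diag n d * S' = A * (S * S')"
    using A S S' by (simp add: AS[symmetric] assoc_mult_mat[of _ n n _ n _ n])
  then have "A = S * mat_diag n d * S'"
    using A S' by simp
  then show ?thesis
    using A S S' by (intro similar_matI[of _ _ S S' n]) auto
qed

section \<open>Trace zero matrices and zero diagonals\<close>

lemma mat_trace_similar:
  fixes A B :: "'a :: comm_ring_1 mat"
  assumes "similar_mat A B"
  shows "mat_trace A = mat_trace B"
proof -
  have comm: "mat_trace (X * Y) = mat_trace (Y * X)"
    if "X \<in> carrier_mat n n" "Y \<in> carrier_mat n n" for X Y :: "'a mat" and n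
  proof -
    have "mat_trace (X * Y) = (\<Sum>i<n. \<Sum>k<n. X $$ (i, k) * Y $$ (k, i))"
      using that by (simp add: mat_trace_def scalar_prod_def atLeast0LessThan)
    also have "\<dots> = (\<Sum>k<n. \<Sum>i<n. Y $$ (k, i) * X $$ (i, k))"
      by (subst sum.swap) (simp add: mult.commute)
    also have "\<dots> = mat_trace (Y * X)"
      using that by (simp add: mat_trace_def scalar_prod_def atLeast0LessThan)
    finally show ?thesis .
  qed
  obtain n P Q where c: "{A,B,P,Q} \<subseteq> carrier_mat n n" and PQ: "Q * P = 1\<^sub>m n" and A: "A = P * B * Q"
    using similar_matD[OF assms] by blast
  have "mat_trace A = mat_trace (Q * (P * B))"
    unfolding A using c by (intro comm) auto
  also have "Q * (P * B) = (Q * P) * B"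
    using c by (intro assoc_mult_mat[symmetric]) auto
  also have "Q * P * B = B" using c PQ by auto
  finally show ?thesis .
qed

text \<open>An elementary conjugation moves \<open>a * C $$ (s, r)\<close> from diagonal entry
  \<open>r\<close> to diagonal entry \<open>s\<close> and fixes the others, so one nonzero
  off-diagonal entry lets \<open>a\<close> be chosen to clear entry \<open>r\<close>.\<close>

lemma clear_diagonal_entry:
  fixes A :: "'a :: field mat"
  assumes A: "A \<in> carrier_mat n n" and ij: "i < n" "j < n"
    and ne: "A $$ (i, i) \<noteq> A $$ (j, j)"
  shows "\<exists>B \<in> carrier_mat n n. similar_mat B A \<and> (B $$ (i, i) = 0 \<or> B $$ (j, j) = 0) \<and>
           (\<forall>k<n. k \<noteq> i \<longrightarrow> k \<noteq> j \<longrightarrow> B $$ (k, k) = A $$ (k, k))"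
proof -
  have *: "\<exists>B \<in> carrier_mat n n. similar_mat B C \<and> B $$ (r, r) = 0 \<and>
           (\<forall>k<n. k \<noteq> r \<longrightarrow> k \<noteq> s \<longrightarrow> B $$ (k, k) = C $$ (k, k))"
    if C: "C \<in> carrier_mat n n" and rs: "r < n" "s < n" "r \<noteq> s" and nz: "C $$ (s, r) \<noteq> 0"
    for C :: "'a mat" and r s
  proof -
    define B where "B = add_col_sub_row (C $$ (r, r) / C $$ (s, r)) r s C"
    have "similar_mat B C" unfolding B_def by (rule add_col_sub_row_similar[OF C rs])
    moreover have "B \<in> carrier_mat n n" unfolding B_def using C by simp
    moreover have "B $$ (r, r) = 0" unfolding B_def using C rs nz by simp
    moreover have "\<forall>k<n. k \<noteq> r \<longrightarrow> k \<noteq> s \<longrightarrow> B $$ (k, k) = C $$ (k, k)"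
      unfolding B_def using C rs by simp
    ultimately show ?thesis by blast
  qed
  have neq: "i \<noteq> j" using ne by auto
  consider "A $$ (j, i) \<noteq> 0" | "A $$ (i, j) \<noteq> 0" | "A $$ (j, i) = 0" "A $$ (i, j) = 0" by blast
  then show ?thesis
  proof cases
    case 1
    then show ?thesis using *[OF A ij neq] by blast
  next
    case 2
    then show ?thesis using *[OF A ij(2,1) neq[symmetric]] by blast
  next
    case 3
    \<comment> \<open>The principal block on \<open>i\<close>, \<open>j\<close> is diagonal here.
      This conjugation keeps the diagonal and puts \<open>A $$ (i, i) - A $$ (j, j)\<close>, nonzero
      by \<open>ne\<close>, at position \<open>(i, j)\<close>.\<close>
    define C where "C = add_col_sub_row 1 i j A"
    have sim: "similar_mat C A" unfolding C_def by (rule add_col_sub_row_similar[OF A ij neq])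
    have C: "C \<in> carrier_mat n n" unfolding C_def using A by simp
    have dC: "\<forall>k<n. C $$ (k, k) = A $$ (k, k)"
      unfolding C_def using A ij neq 3 by simp
    have "C $$ (i, j) \<noteq> 0"
      unfolding C_def using A ij neq 3 ne by simp
    from *[OF C ij(2,1) neq[symmetric] this] show ?thesis
      using dC sim similar_mat_trans by metis
  qed
qed

text \<open>Induction on the number of nonzero diagonal entries: two distinct ones allow clearing at
  least one of them without disturbing the rest of the diagonal.\<close>

lemma sl_mat_similar_zero_diagonal:
  fixes T :: "'a :: field_char_0 mat"
  assumes "T \<in> sl_mat n"
  shows "\<exists>B \<in> carrier_mat n n. similar_mat B T \<and> (\<forall>i<n. B $$ (i, i) = 0)"
  using assms
proof (induction "card {i. i < n \<and> T $$ (i, i) \<noteq> 0}" arbitrary: T rule: less_induct)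
  case less
  let ?N = "{i. i < n \<and> T $$ (i, i) \<noteq> 0}"
  have T: "T \<in> carrier_mat n n" and tr: "mat_trace T = 0"
    using less.prems by (auto simp: sl_mat_def)
  show ?case
  proof (cases "?N = {}")
    case True
    then show ?thesis using T similar_mat_refl[OF T] by blast
  next
    case False
    then obtain i where i: "i \<in> ?N" by blast
    \<comment> \<open>If all nonzero diagonal entries were equal, the trace would be a positive
      integer multiple of a nonzero element, hence nonzero in characteristic 0.\<close>
    have "\<exists>j\<in>?N. T $$ (i, i) \<noteq> T $$ (j, j)"
    proof (rule ccontr)
      assume "\<not> ?thesis"
      then have eq: "\<forall>j\<in>?N. T $$ (j, j) = T $$ (i, i)" by metis
      have "mat_trace T = (\<Sum>j\<in>?N. T $$ (j, j))"
        unfolding mat_trace_def using T by (intro sum.mono_neutral_right) auto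
      also have "\<dots> = (\<Sum>j\<in>?N. T $$ (i, i))"
        using eq by (intro sum.cong) auto
      also have "\<dots> = of_nat (card ?N) * T $$ (i, i)"
        by simp
      finally show False using tr i by (auto simp: card_eq_0_iff)
    qed
    then obtain j where j: "j \<in> ?N" and ne: "T $$ (i, i) \<noteq> T $$ (j, j)" by blast
    obtain B where B: "B \<in> carrier_mat n n" "similar_mat B T"
      and z: "B $$ (i, i) = 0 \<or> B $$ (j, j) = 0"
      and keep: "\<forall>k<n. k \<noteq> i \<longrightarrow> k \<noteq> j \<longrightarrow> B $$ (k, k) = T $$ (k, k)"
      using clear_diagonal_entry[OF T _ _ ne] i j by blast
    have "{k. k < n \<and> B $$ (k, k) \<noteq> 0} \<subset> ?N"
      using z keep i j by (auto 0 4)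
    then have "card {k. k < n \<and> B $$ (k, k) \<noteq> 0} < card ?N"
      by (intro psubset_card_mono) auto
    moreover have "B \<in> sl_mat n"
      using B tr mat_trace_similar[OF B(2)] by (simp add: sl_mat_def)
    ultimately obtain C where "C \<in> carrier_mat n n" "similar_mat C B" "\<forall>i<n. C $$ (i, i) = 0"
      using less.hyps by blast
    then show ?thesis using B similar_mat_trans by blast
  qed
qed

section \<open>Matrices similar to \<open>D\<close> with prescribed entries\<close>

lemma similar_diag_prescribed_corner:
  fixes l :: "nat \<Rightarrow> 'a :: field" and T :: "'a mat"
  assumes q: "0 < q" "q \<le> n" "n \<le> 2 * q"
    and inj: "inj_on l {..<q}" and nz: "\<And>i. i < q \<Longrightarrow> l i \<noteq> 0"
    and T: "\<And>i. q \<le> i \<Longrightarrow> i < n \<Longrightarrow> T $$ (i, i) = 0"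
  defines "d \<equiv> \<lambda>i. if i < q then l i else 0"
  shows "\<exists>A \<in> carrier_mat n n. similar_mat A (mat_diag n d) \<and> (\<forall>i<n. A $$ (i, i) = d i) \<and>
           (\<forall>i j. q \<le> i \<longrightarrow> i < n \<longrightarrow> q \<le> j \<longrightarrow> j < n \<longrightarrow> A $$ (i, j) = T $$ (i, j))"
proof -
  \<comment> \<open>In block form \<open>B = (\<Lambda>, R; 0, 0)\<close> and \<open>A = (I, 0; Y, I) B (I, 0; -Y, I) = (\<Lambda> - R Y, R; *, Y R)\<close>
    with \<open>Y = (I, 0)\<close> and \<open>R\<close> the lower right block of \<open>T\<close> padded with zero rows.\<close>
  define B where "B = mat n n (\<lambda>(i, j). if i = j then d i
     else if i < q \<and> q \<le> j \<and> i + q < n then T $$ (i + q, j) else 0)"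
  \<comment> \<open>\<open>P\<close> adds row \<open>i - q\<close> to row \<open>i\<close>. The
    guard \<open>q \<le> i\<close> is essential, since subtraction on naturals truncates.\<close>
  define P where "P = mat n n (\<lambda>(i, k). (if k = i then 1 else 0) + (if q \<le> i \<and> k = i - q then 1 else 0) :: 'a)"
  define Q where "Q = mat n n (\<lambda>(k, j). (if k = j then 1 else 0) - (if k = j + q then 1 else 0) :: 'a)"
  have B: "B \<in> carrier_mat n n" and P: "P \<in> carrier_mat n n" and Q: "Q \<in> carrier_mat n n"
    by (simp_all add: B_def P_def Q_def)
  have PX: "(P * X) $$ (i, j) = X $$ (i, j) + (if q \<le> i then X $$ (i - q, j) else 0)"
    if "X \<in> carrier_mat n n" "i < n" "j < n" for X i j
    using that q less_imp_diff_less[of i n q]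
    by (simp add: P_def scalar_prod_def distrib_right sum.distrib if_distrib[of "\<lambda>x. x * _"]
        cong: if_cong)
  have XQ: "(X * Q) $$ (i, j) = X $$ (i, j) - (if j + q < n then X $$ (i, j + q) else 0)"
    if "X \<in> carrier_mat n n" "i < n" "j < n" for X i j
    using that q
    by (simp add: Q_def scalar_prod_def right_diff_distrib sum_subtractf if_distrib[of "\<lambda>x. _ * x"]
        cong: if_cong)
  have PQ: "P * Q = 1\<^sub>m n"
  proof (rule eq_matI)
    fix i j assume "i < dim_row (1\<^sub>m n)" "j < dim_col (1\<^sub>m n)"
    then have ij: "i < n" "j < n" by auto
    show "(P * Q) $$ (i, j) = 1\<^sub>m n $$ (i, j)"
      unfolding PX[OF Q ij] using ij q by (auto simp: Q_def)
  qed (use P Q in auto)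
  have QP: "Q * P = 1\<^sub>m n"
    by (rule mat_mult_left_right_inverse[OF P Q PQ])
  define A where "A = P * B * Q"
  have A: "A \<in> carrier_mat n n" using P B Q by (simp add: A_def)
  have A_entry: "A $$ (i, j) = B $$ (i, j) + (if q \<le> i then B $$ (i - q, j) else 0)
      - (if j + q < n then B $$ (i, j + q) + (if q \<le> i then B $$ (i - q, j + q) else 0) else 0)"
    if "i < n" "j < n" for i j
    using that P B by (simp add: A_def XQ PX del: index_mult_mat(1))
  have "similar_mat B (mat_diag n d)"
  proof (rule upper_triangular_similar_mat_diag[OF B])
    show "upper_triangular B" by (rule upper_triangularI) (auto simp: B_def)
    show "B $$ (i, i) = d i" if "i < n" for i using that by (simp add: B_def)
    show "B $$ (i, k) = 0" if "i < j" "j < n" "d i = d j" "i < k" "k < n" for i j k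
    proof -
      \<comment> \<open>Only the value 0 of \<open>d\<close> can repeat, because the
        \<open>l i\<close> are distinct and nonzero.\<close>
      have "q \<le> i" using that inj nz[of i] by (auto simp: d_def inj_on_def split: if_splits)
      then show ?thesis using that by (simp add: B_def)
    qed
  qed
  moreover have "similar_mat A B"
    using A B P Q PQ QP by (intro similar_matI[of _ _ P Q n]) (auto simp: A_def)
  ultimately have "similar_mat A (mat_diag n d)" using similar_mat_trans by blast
  \<comment> \<open>Both \<open>R Y\<close> and \<open>Y R\<close> have only diagonal entries of
    \<open>T\<close> from the corner, or zeros, on their diagonals, so \<open>T\<close> having zeros
    there keeps the diagonal equal to \<open>d\<close>.\<close>
  moreover have "A $$ (i, i) = d i" if "i < n" for i
    using that q T by (simp add: A_entry) (auto simp: B_def)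
  moreover have "A $$ (i, j) = T $$ (i, j)" if "q \<le> i" "i < n" "q \<le> j" "j < n" for i j
    using that q T by (simp add: A_entry) (auto simp: B_def d_def)
  ultimately show ?thesis using A by blast
qed

text \<open>Rows whose diagonal entry recurs further down have index at least \<open>q\<close>, and
  there \<open>U\<close> vanishes, so the triangular criterion applies.\<close>

lemma similar_diag_upper_perturbation:
  fixes l :: "nat \<Rightarrow> 'a :: field"
  assumes inj: "inj_on l {..<q}" and nz: "\<And>i. i < q \<Longrightarrow> l i \<noteq> 0"
    and U: "\<And>i j. q \<le> i \<Longrightarrow> i < j \<Longrightarrow> j < n \<Longrightarrow> U i j = 0"
  defines "d \<equiv> \<lambda>i. if i < q then l i else 0"
  shows "similar_mat (mat n n (\<lambda>(i, j). if i = j then d i else if i < j then U i j else 0)) (mat_diag n d)"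
proof (rule upper_triangular_similar_mat_diag)
  fix i j k assume *: "i < j" "j < n" "d i = d j" "i < k" "k < n"
  have "q \<le> i" using * inj nz[of i] by (auto simp: d_def inj_on_def split: if_splits)
  then show "mat n n (\<lambda>(i, j). if i = j then d i else if i < j then U i j else 0) $$ (i, k) = 0"
    using * U by simp
qed auto

section \<open>Assembling the three summands\<close>

theorem theorem2p1:
  fixes n q :: nat
    and l :: "nat \<Rightarrow> 'a :: field_char_0"
    and D T :: "'a mat"
    and \<alpha>\<^sub>1 \<alpha>\<^sub>2 \<alpha>\<^sub>3 :: 'a
  assumes "n \<ge> 2" and "q > 0"
    and "real n / 2 \<le> real q" and "q \<le> n"
    and "inj_on l {..<q}" and "\<And>i. i < q \<Longrightarrow> l i \<noteq> 0"
    and "D = mat_diag n (\<lambda>i. if i < q then l i else 0)"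
    and "\<alpha>\<^sub>1 \<noteq> 0" and "\<alpha>\<^sub>2 \<noteq> 0" and "\<alpha>\<^sub>3 \<noteq> 0"
    and "\<alpha>\<^sub>1 + \<alpha>\<^sub>2 + \<alpha>\<^sub>3 = 0"
    and "T \<in> sl_mat n"
  shows "\<exists>A\<^sub>1 \<in> carrier_mat n n. \<exists>A\<^sub>2 \<in> carrier_mat n n. \<exists>A\<^sub>3 \<in> carrier_mat n n.
           similar_mat A\<^sub>1 D \<and> similar_mat A\<^sub>2 D \<and> similar_mat A\<^sub>3 D \<and>
           T = \<alpha>\<^sub>1 \<cdot>\<^sub>m A\<^sub>1 + \<alpha>\<^sub>2 \<cdot>\<^sub>m A\<^sub>2 + \<alpha>\<^sub>3 \<cdot>\<^sub>m A\<^sub>3"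
proof -
  note inj = assms(5) and nz = assms(6) and D = assms(7) and a1 = assms(8) and a2 = assms(9)
    and a3 = assms(10) and asum = assms(11)
  define d where "d = (\<lambda>i. if i < q then l i else 0)"
  have D': "D = mat_diag n d" by (simp add: D d_def)
  obtain Z where Z: "Z \<in> carrier_mat n n" and sim: "similar_mat T Z" and Z0: "\<And>i. i < n \<Longrightarrow> Z $$ (i, i) = 0"
    using sl_mat_similar_zero_diagonal[OF assms(12)] similar_mat_sym by metis
  have q2: "n \<le> 2 * q" using assms(3) by linarith
  \<comment> \<open>The scaling makes the corner of
    \<open>\<alpha>\<^sub>3 \<cdot>\<^sub>m B3\<close> agree with that of \<open>Z\<close>.\<close>
  define W where "W = (1 / \<alpha>\<^sub>3) \<cdot>\<^sub>m Z"
  obtain B3 where B3: "B3 \<in> carrier_mat n n" and s3: "similar_mat B3 D"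
    and B3d: "\<And>i. i < n \<Longrightarrow> B3 $$ (i, i) = d i"
    and B3c: "\<And>i j. q \<le> i \<Longrightarrow> i < n \<Longrightarrow> q \<le> j \<Longrightarrow> j < n \<Longrightarrow> B3 $$ (i, j) = W $$ (i, j)"
    using similar_diag_prescribed_corner[OF assms(2,4) q2 inj nz, of W] Z Z0
    unfolding D' d_def W_def by auto
  define X where "X = Z - \<alpha>\<^sub>3 \<cdot>\<^sub>m B3"
  have X0: "X $$ (i, j) = 0" if "q \<le> i" "i < n" "q \<le> j" "j < n" for i j
    using that Z B3 a3 by (simp add: X_def B3c W_def)
  define B1 where "B1 = mat n n (\<lambda>(i, j). if i = j then d i else if i < j then X $$ (i, j) / \<alpha>\<^sub>1 else 0)"
  \<comment> \<open>The part of \<open>X\<close> below the diagonal is stored transposed, so that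
    the upper triangular lemma serves for both halves; symmetry of \<open>D\<close> then gives
    similarity of the transpose.\<close>
  define B2t where "B2t = mat n n (\<lambda>(i, j). if i = j then d i else if i < j then X $$ (j, i) / \<alpha>\<^sub>2 else 0)"
  have s1: "similar_mat B1 D" and s2t: "similar_mat B2t D"
    unfolding B1_def B2t_def D' d_def
    by (rule similar_diag_upper_perturbation[OF inj nz]; simp add: X0)+
  have "D\<^sup>T = D" by (auto simp: D mat_diag_def)
  then have s2: "similar_mat B2t\<^sup>T D" using similar_mat_transpose[OF s2t] by simp
  have B1: "B1 \<in> carrier_mat n n" and B2: "B2t\<^sup>T \<in> carrier_mat n n"
    by (simp_all add: B1_def B2t_def)
  have Z_eq: "Z = \<alpha>\<^sub>1 \<cdot>\<^sub>m B1 + \<alpha>\<^sub>2 \<cdot>\<^sub>m B2t\<^sup>T + \<alpha>\<^sub>3 \<cdot>\<^sub>m B3" (is "_ = ?R")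
  proof (rule eq_matI)
    fix i j assume "i < dim_row ?R" "j < dim_col ?R"
    then have ij: "i < n" "j < n" using B3 by auto
    \<comment> \<open>This settles the diagonal, where \<open>Z\<close> is 0 and all three matrices
      have entries \<open>d i\<close>.\<close>
    have "(\<alpha>\<^sub>1 + \<alpha>\<^sub>2 + \<alpha>\<^sub>3) * d i = 0" by (simp add: asum)
    then have "\<alpha>\<^sub>1 * d i + \<alpha>\<^sub>2 * d i + \<alpha>\<^sub>3 * d i = 0"
      by (simp add: distrib_right)
    moreover have "X $$ (i, j) + \<alpha>\<^sub>3 * B3 $$ (i, j) = Z $$ (i, j)"
      using ij Z B3 by (simp add: X_def)
    ultimately show "Z $$ (i, j) = ?R $$ (i, j)"
      using ij B3 a1 a2 Z0 B3d by (auto simp: B1_def B2t_def)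
  qed (use Z B3 in auto)
  obtain m P Q where c: "{T,Z,P,Q} \<subseteq> carrier_mat m m" and PQ: "P * Q = 1\<^sub>m m" "Q * P = 1\<^sub>m m"
    and T: "T = P * Z * Q"
    using similar_matD[OF sim] by blast
  have m: "m = n" using c Z by auto
  have P: "P \<in> carrier_mat n n" and Q: "Q \<in> carrier_mat n n" using c m by auto
  \<comment> \<open>Conjugation by \<open>P\<close> is linear and preserves similarity to
    \<open>D\<close>, so the decomposition of \<open>Z\<close> carries over to
    \<open>T\<close>.\<close>
  have conj: "similar_mat (P * B * Q) D" if "B \<in> carrier_mat n n" "similar_mat B D" for B
    by (rule similar_mat_trans[OF similar_matI[of _ _ P Q n]]) (use that P Q PQ m in auto)
  have "T = \<alpha>\<^sub>1 \<cdot>\<^sub>m (P * B1 * Q) + \<alpha>\<^sub>2 \<cdot>\<^sub>m (P * B2t\<^sup>T * Q) + \<alpha>\<^sub>3 \<cdot>\<^sub>m (P * B3 * Q)"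
    unfolding T Z_eq using P Q B1 B2 B3
    by (simp add: mult_add_distrib_mat[of _ n n _ n] add_mult_distrib_mat[of _ n n _ _ n]
        mult_smult_distrib[of _ n n _ n] mult_smult_assoc_mat[of _ n n _ n])
  moreover have "P * B1 * Q \<in> carrier_mat n n" "P * B2t\<^sup>T * Q \<in> carrier_mat n n" "P * B3 * Q \<in> carrier_mat n n"
    using P Q B1 B2 B3 by auto
  ultimately show ?thesis
    using conj[OF B1 s1] conj[OF B2 s2] conj[OF B3 s3] by blast
qed

end
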